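(* Let $(X_n,Y_n)=G_n(x,y)$ with $X_n,Y_n\in\mathbb{Z}[x,y]$ be the $n$th folding map for the Lie algebra $\mathcal{G}_2$. (a) For $n\ge5$, the top order terms of $X_n$ satisfy $$X_n=x^n-nx^{n-2}y+\frac{n^2-3n}{2}x^{n-4}y^2-nx^{n-3}y-3nx^{n-2}+O(n-3).$$ (b) $Y_0=6$, and for $n\ge1$ the top order term of $Y_n$ is given by $$Y_n=\begin{cases}(-1)^{n/2}\,2\,x^{3n/2}+O\left(\frac{3n-2}{2}\right)&\text{if $n$ is even},\\[4pt](-1)^{(n-1)/2}\,n\,x^{(3n-3)/2}\,y+O\left(\frac{3n-3}{2}\right)&\text{if $n$ is odd}.\end{cases}$$
   Context: The notation $O(d)$ stands for some polynomial in $x,y$ of total degree at most $d$. The polynomials $X_n,Y_n$ are given by: $X_0=6$, $Y_0=6$; $X_1=x$, $Y_1=y$; $X_2=x^2-2x-2y-6$, $Y_2=-2x^3+6xy+y^2+18x+10y+18$; $X_3=x^3-3xy-9x-6y-12$, $Y_3=-3x^3y-6x^3+9xy^2+y^3+45xy+18y^2+54x+63y+60$; $X_4=x^4-4x^2y-10x^2-4xy+2y^2-8x+8y+6$, $Y_4=2x^6-12x^4y-4x^3y^2-36x^4-28x^3y+18x^2y^2+12xy^3+y^4-40x^3+108x^2y+120xy^2+24y^3+162x^2+372xy+134y^2+360x+280y+198$; $X_5=x^5-5x^3y-15x^3-5x^2y+5xy^2-10x^2+35xy+10y^2+55x+50y+60$, $Y_5=5x^6y+10x^6-30x^4y^2-5x^3y^3-150x^4y-65x^3y^2+45x^2y^3+15xy^4+y^5-180x^4-205x^3y+360x^2y^2+240xy^3+30y^4-190x^3+945x^2y+1200xy^2+255y^3+810x^2+2415xy+920y^2+1710x+1495y+900$;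 and for $n\ge0$ $$X_{n+6}=x(X_{n+5}+X_{n+1})-(x+y+3)(X_{n+4}+X_{n+2})+(x^2-2y-4)X_{n+3}-X_n,$$ $$Y_{n+6}=y(Y_{n+5}+Y_{n+1})-(x^3-3xy-9x-5y-9)(Y_{n+4}+Y_{n+2})+(y^2-2x^3+6xy+18x+12y+20)Y_{n+3}-Y_n.$$ *)

theory Defs
  imports "HOL-Computational_Algebra.Polynomial"
begin

text \<open>
  The ring \<open>\<int>[x,y]\<close> is rendered as \<open>\<int>[x][y]\<close>, that is \<^typ>\<open>int poly poly\<close>: the outer
  polynomial variable is \<open>y\<close>, the inner one is \<open>x\<close>, so the coefficient of \<open>x\<^sup>i y\<^sup>j\<close> in
  \<open>p\<close> is \<open>coeff (coeff p j) i\<close>.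
\<close>

definition \<x> :: "int poly poly" where
  "\<x> = [:[:0, 1:]:]"

definition \<y> :: "int poly poly" where
  "\<y> = [:0, 1:]"

text \<open>\<open>O_deg d\<close> is the set of polynomials of total degree at most \<open>d\<close>, with the zero
  polynomial included for every \<open>d\<close>.\<close>

definition O_deg :: "nat \<Rightarrow> int poly poly set" where
  "O_deg d = {p. \<forall>i j. coeff (coeff p j) i \<noteq> 0 \<longrightarrow> i + j \<le> d}"

text \<open>
  \<open>G\<^sub>n(x, y) = (X\<^sub>n, Y\<^sub>n)\<close> is the \<open>n\<close>-th folding map of the Lie algebra \<open>G\<^sub>2\<close>. The
  normalisation is the one in which \<open>x\<close> and \<open>y\<close> are the sums of the formal exponentials of the
  six short and of the six long roots, and \<open>X\<^sub>n\<close>, \<open>Y\<^sub>n\<close> are the same sums over the \<open>n\<close>-fold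
  multiples of these roots; hence \<open>X\<^sub>0 = Y\<^sub>0 = 6\<close>.
\<close>

fun G2_X :: "nat \<Rightarrow> int poly poly" where
  "G2_X 0 = 6"
| "G2_X (Suc 0) = \<x>"
| "G2_X (Suc (Suc 0)) = \<x>^2 - 2*\<x> - 2*\<y> - 6"
| "G2_X (Suc (Suc (Suc 0))) = \<x>^3 - 3*\<x>*\<y> - 9*\<x> - 6*\<y> - 12"
| "G2_X (Suc (Suc (Suc (Suc 0)))) =
     \<x>^4 - 4*\<x>^2*\<y> - 10*\<x>^2 - 4*\<x>*\<y> + 2*\<y>^2 - 8*\<x> + 8*\<y> + 6"
| "G2_X (Suc (Suc (Suc (Suc (Suc 0))))) =
     \<x>^5 - 5*\<x>^3*\<y> - 15*\<x>^3 - 5*\<x>^2*\<y> + 5*\<x>*\<y>^2 - 10*\<x>^2 + 35*\<x>*\<y> + 10*\<y>^2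
     + 55*\<x> + 50*\<y> + 60"
| "G2_X (Suc (Suc (Suc (Suc (Suc (Suc n)))))) =
     \<x> * (G2_X (n+5) + G2_X (n+1))
     - (\<x> + \<y> + 3) * (G2_X (n+4) + G2_X (n+2))
     + (\<x>^2 - 2*\<y> - 4) * G2_X (n+3)
     - G2_X n"

fun G2_Y :: "nat \<Rightarrow> int poly poly" where
  "G2_Y 0 = 6"
| "G2_Y (Suc 0) = \<y>"
| "G2_Y (Suc (Suc 0)) = -2*\<x>^3 + 6*\<x>*\<y> + \<y>^2 + 18*\<x> + 10*\<y> + 18"
| "G2_Y (Suc (Suc (Suc 0))) =
     -3*\<x>^3*\<y> - 6*\<x>^3 + 9*\<x>*\<y>^2 + \<y>^3 + 45*\<x>*\<y> + 18*\<y>^2 + 54*\<x> + 63*\<y> + 60"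
| "G2_Y (Suc (Suc (Suc (Suc 0)))) =
     2*\<x>^6 - 12*\<x>^4*\<y> - 4*\<x>^3*\<y>^2 - 36*\<x>^4 - 28*\<x>^3*\<y> + 18*\<x>^2*\<y>^2 + 12*\<x>*\<y>^3 + \<y>^4
     - 40*\<x>^3 + 108*\<x>^2*\<y> + 120*\<x>*\<y>^2 + 24*\<y>^3 + 162*\<x>^2 + 372*\<x>*\<y> + 134*\<y>^2
     + 360*\<x> + 280*\<y> + 198"
| "G2_Y (Suc (Suc (Suc (Suc (Suc 0))))) =
     5*\<x>^6*\<y> + 10*\<x>^6 - 30*\<x>^4*\<y>^2 - 5*\<x>^3*\<y>^3 - 150*\<x>^4*\<y> - 65*\<x>^3*\<y>^2
     + 45*\<x>^2*\<y>^3 + 15*\<x>*\<y>^4 + \<y>^5 - 180*\<x>^4 - 205*\<x>^3*\<y> + 360*\<x>^2*\<y>^2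
     + 240*\<x>*\<y>^3 + 30*\<y>^4 - 190*\<x>^3 + 945*\<x>^2*\<y> + 1200*\<x>*\<y>^2 + 255*\<y>^3
     + 810*\<x>^2 + 2415*\<x>*\<y> + 920*\<y>^2 + 1710*\<x> + 1495*\<y> + 900"
| "G2_Y (Suc (Suc (Suc (Suc (Suc (Suc n)))))) =
     \<y> * (G2_Y (n+5) + G2_Y (n+1))
     - (\<x>^3 - 3*\<x>*\<y> - 9*\<x> - 5*\<y> - 9) * (G2_Y (n+4) + G2_Y (n+2))
     + (\<y>^2 - 2*\<x>^3 + 6*\<x>*\<y> + 18*\<x> + 12*\<y> + 20) * G2_Y (n+3)
     - G2_Y n"

end

theory Submission
  imports Defs
begin

text \<open>
  Total degree filters \<open>\<int>[x,y]\<close>. For \<open>X\<close>, a crude induction gives degree at most \<open>n\<close>, a second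
  one the two leading terms \<open>x\<^sup>n - n x\<^sup>n\<^sup>-\<^sup>2 y\<close> up to \<open>O(n - 2)\<close>. With these, the recurrence
  determines \<open>X\<^sub>n - x X\<^sub>n\<^sub>-\<^sub>1\<close> up to \<open>O(n - 3)\<close>, so the full expansion follows by simple induction
  from \<open>n = 5\<close>. For \<open>Y\<close>, the bound \<open>\<lfloor>3n/2\<rfloor>\<close> on the degree reduces the recurrence modulo lower order
  terms to \<open>Y\<^sub>n = - x\<^sup>3 Y\<^sub>n\<^sub>-\<^sub>2\<close> for even \<open>n\<close> and \<open>Y\<^sub>n = y Y\<^sub>n\<^sub>-\<^sub>1 - x\<^sup>3 Y\<^sub>n\<^sub>-\<^sub>2\<close> for odd \<open>n\<close>.
\<close>

section \<open>The filtration of the polynomial ring by total degree\<close>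

lemma O_deg_mono: "p \<in> O_deg d \<Longrightarrow> d \<le> e \<Longrightarrow> p \<in> O_deg e"
  by (force simp: O_deg_def)

lemma O_deg_add: "p \<in> O_deg d \<Longrightarrow> q \<in> O_deg e \<Longrightarrow> p + q \<in> O_deg (max d e)"
  unfolding O_deg_def mem_Collect_eq coeff_add le_max_iff_disj by (metis add_0)

lemma O_deg_uminus: "p \<in> O_deg d \<Longrightarrow> - p \<in> O_deg d"
  by (simp add: O_deg_def)

lemma O_deg_diff: "p \<in> O_deg d \<Longrightarrow> q \<in> O_deg e \<Longrightarrow> p - q \<in> O_deg (max d e)"
  using O_deg_add[OF _ O_deg_uminus] by fastforce

text \<open>A coefficient of \<open>p * q\<close> is a double convolution; if it is nonzero, some
  summand is nonzero, and the exponents of its two factors add up to \<open>i\<close> and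
  \<open>j\<close>.\<close>

lemma O_deg_mult:
  assumes "p \<in> O_deg d" "q \<in> O_deg e"
  shows "p * q \<in> O_deg (d + e)"
  unfolding O_deg_def
proof (intro CollectI allI impI)
  fix i j
  assume "coeff (coeff (p * q) j) i \<noteq> 0"
  then have "(\<Sum>b\<le>j. \<Sum>a\<le>i. coeff (coeff p b) a * coeff (coeff q (j - b)) (i - a)) \<noteq> 0"
    by (simp add: coeff_mult coeff_sum)
  then obtain b where b: "b \<in> {..j}"
    "(\<Sum>a\<le>i. coeff (coeff p b) a * coeff (coeff q (j - b)) (i - a)) \<noteq> 0"
    by (rule sum.not_neutral_contains_not_neutral)
  then obtain a where a: "a \<in> {..i}" "coeff (coeff p b) a * coeff (coeff q (j - b)) (i - a) \<noteq> 0"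
    by (elim sum.not_neutral_contains_not_neutral)
  from a(2) have "coeff (coeff p b) a \<noteq> 0" "coeff (coeff q (j - b)) (i - a) \<noteq> 0"
    by auto
  with assms have "a + b \<le> d" "(i - a) + (j - b) \<le> e"
    unfolding O_deg_def by blast+
  with a b show "i + j \<le> d + e" by simp
qed

lemma O_deg_of_int: "of_int c \<in> O_deg 0"
  by (auto simp: O_deg_def of_int_poly coeff_pCons split: nat.splits)

lemma O_deg_of_nat: "of_nat c \<in> O_deg 0"
  using O_deg_of_int[of "int c"] by simp

lemma O_deg_numeral: "numeral c \<in> O_deg 0"
  using O_deg_of_int[of "numeral c"] by simp

lemma O_deg_one: "1 \<in> O_deg 0"
  using O_deg_of_int[of 1] by simp

lemma O_deg_x: "\<x> \<in> O_deg 1"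
  by (auto simp: O_deg_def \<x>_def coeff_pCons split: nat.splits)

lemma O_deg_y: "\<y> \<in> O_deg 1"
  by (auto simp: O_deg_def \<y>_def coeff_pCons split: nat.splits)

lemma O_deg_power: "p \<in> O_deg d \<Longrightarrow> p ^ n \<in> O_deg (n * d)"
  by (induction n) (auto intro: O_deg_one O_deg_mult)

lemma O_deg_remainder: "p - q \<in> O_deg d \<Longrightarrow> \<exists>R\<in>O_deg d. p = q + R"
  by (rule bexI[of _ "p - q"]) auto

text \<open>After \<open>O_deg_mono\<close> the degree is schematic, so these rules compute a bound
  from the syntax of a polynomial. The result is built from \<open>max\<close>, sums and products;
  \<open>max_le_simps\<close> splits its comparison with the target into inequalities without
  \<open>max\<close>.\<close>

lemmas O_deg_intros = O_deg_add O_deg_diff O_deg_uminus O_deg_mult O_deg_power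
  O_deg_x O_deg_y O_deg_of_nat O_deg_of_int O_deg_numeral O_deg_one

lemmas max_le_simps = max.bounded_iff max_add_distrib_left max_add_distrib_right

section \<open>Recurrences and initial values\<close>

text \<open>Rewriting with \<open>numeral_eq_Suc\<close> puts indices into successor form, where the
  recursive equations would otherwise unfold.\<close>

declare G2_X.simps(7) [simp del] G2_Y.simps(7) [simp del]

lemma G2_X_rec:
  "G2_X (n + 6) = \<x> * (G2_X (n + 5) + G2_X (n + 1))
     - (\<x> + \<y> + 3) * (G2_X (n + 4) + G2_X (n + 2))
     + (\<x>^2 - 2*\<y> - 4) * G2_X (n + 3) - G2_X n"
proof -
  have "n + 6 = Suc (Suc (Suc (Suc (Suc (Suc n)))))" by simp
  then show ?thesis by (simp only: G2_X.simps)
qed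

lemma G2_Y_rec:
  "G2_Y (n + 6) = \<y> * (G2_Y (n + 5) + G2_Y (n + 1))
     - (\<x>^3 - 3*\<x>*\<y> - 9*\<x> - 5*\<y> - 9) * (G2_Y (n + 4) + G2_Y (n + 2))
     + (\<y>^2 - 2*\<x>^3 + 6*\<x>*\<y> + 18*\<x> + 12*\<y> + 20) * G2_Y (n + 3) - G2_Y n"
proof -
  have "n + 6 = Suc (Suc (Suc (Suc (Suc (Suc n)))))" by simp
  then show ?thesis by (simp only: G2_Y.simps)
qed

lemma G2_init:
  "G2_X 3 = \<x>^3 - 3*\<x>*\<y> - 9*\<x> - 6*\<y> - 12" (is ?g1)
  "G2_X 4 = \<x>^4 - 4*\<x>^2*\<y> - 10*\<x>^2 - 4*\<x>*\<y> + 2*\<y>^2 - 8*\<x> + 8*\<y> + 6" (is ?g2)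
  "G2_X 5 = \<x>^5 - 5*\<x>^3*\<y> - 15*\<x>^3 - 5*\<x>^2*\<y> + 5*\<x>*\<y>^2 - 10*\<x>^2 + 35*\<x>*\<y> + 10*\<y>^2
     + 55*\<x> + 50*\<y> + 60" (is ?g3)
  "G2_Y 2 = -2*\<x>^3 + 6*\<x>*\<y> + \<y>^2 + 18*\<x> + 10*\<y> + 18" (is ?g4)
  "G2_Y 3 = -3*\<x>^3*\<y> - 6*\<x>^3 + 9*\<x>*\<y>^2 + \<y>^3 + 45*\<x>*\<y> + 18*\<y>^2 + 54*\<x> + 63*\<y> + 60" (is ?g5)
  "G2_Y 4 = 2*\<x>^6 - 12*\<x>^4*\<y> - 4*\<x>^3*\<y>^2 - 36*\<x>^4 - 28*\<x>^3*\<y> + 18*\<x>^2*\<y>^2 + 12*\<x>*\<y>^3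
     + \<y>^4 - 40*\<x>^3 + 108*\<x>^2*\<y> + 120*\<x>*\<y>^2 + 24*\<y>^3 + 162*\<x>^2 + 372*\<x>*\<y> + 134*\<y>^2
     + 360*\<x> + 280*\<y> + 198" (is ?g6)
  "G2_Y 5 = 5*\<x>^6*\<y> + 10*\<x>^6 - 30*\<x>^4*\<y>^2 - 5*\<x>^3*\<y>^3 - 150*\<x>^4*\<y> - 65*\<x>^3*\<y>^2
     + 45*\<x>^2*\<y>^3 + 15*\<x>*\<y>^4 + \<y>^5 - 180*\<x>^4 - 205*\<x>^3*\<y> + 360*\<x>^2*\<y>^2
     + 240*\<x>*\<y>^3 + 30*\<y>^4 - 190*\<x>^3 + 945*\<x>^2*\<y> + 1200*\<x>*\<y>^2 + 255*\<y>^3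
     + 810*\<x>^2 + 2415*\<x>*\<y> + 920*\<y>^2 + 1710*\<x> + 1495*\<y> + 900" (is ?g7)
proof -
  have n: "2 = Suc (Suc 0)" "3 = Suc (Suc (Suc 0))"
    "4 = Suc (Suc (Suc (Suc 0)))" "5 = Suc (Suc (Suc (Suc (Suc 0))))"
    by simp_all
  show ?g1 ?g2 ?g3 ?g4 ?g5 ?g6 ?g7
    by (simp_all only: n G2_X.simps G2_Y.simps)
qed

section \<open>Crude degree bounds\<close>

lemma G2_X_deg: "G2_X n \<in> O_deg n"
proof (induction n rule: G2_X.induct)
  case (7 n)
  show ?case unfolding G2_X.simps
    by (rule O_deg_mono, (rule 7 O_deg_intros)+) (simp only: max_le_simps, simp)
qed (unfold G2_X.simps, (rule O_deg_mono, (rule O_deg_intros)+, 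
    (simp only: max_le_simps)?, (simp; fail)?)+)

lemma add_half_le_half: "2 * c + a \<le> b \<Longrightarrow> c + a div 2 \<le> b div 2" for a b c :: nat
  by linarith

text \<open>The \<open>+ 1\<close> is the gain from rounding down; the largest terms in the parity
  steps for \<open>G2_Y\<close> use it up exactly.\<close>

lemma add_half_le: "2 * c + a \<le> 2 * b + 1 \<Longrightarrow> c + a div 2 \<le> b" for a b c :: nat
  by linarith

lemma half_le: "a \<le> 2 * b + 1 \<Longrightarrow> a div 2 \<le> b" for a b :: nat
  by linarith

text \<open>A coefficient of degree \<open>c\<close> in front of the term \<open>j\<close> indices
  back always satisfies \<open>2 * c \<le> 3 * j\<close>. For \<open>j > 0\<close> equality holds
  only for the cubic coefficient at \<open>j = 2\<close>, which fixes the growth rate 3/2.\<close>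

lemma G2_Y_deg: "G2_Y n \<in> O_deg (3 * n div 2)"
proof (induction n rule: G2_Y.induct)
  case (7 n)
  show ?case unfolding G2_Y.simps
    by (rule O_deg_mono, (rule 7 O_deg_intros)+) 
       (simp only: max_le_simps, intro conjI add_half_le_half div_le_mono; simp)
qed (unfold G2_Y.simps, (rule O_deg_mono, (rule O_deg_intros)+, 
    (simp only: max_le_simps)?, (simp; fail)?)+)

section \<open>Top order terms of \<open>G2_X\<close>\<close>

text \<open>The index starts at 3 because at index 2 the term \<open>-2*\<x>\<close> would exceed
  the allowed degree 0.\<close>

lemma G2_X_two_terms:
  "G2_X (n + 3) - (\<x>^(n+3) - of_nat (n + 3) * \<x>^(n+1) * \<y>) \<in> O_deg (n + 1)"
proof (induction n rule: less_induct)
  case (less n)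
  have "n = 0 \<or> n = 1 \<or> n = 2 \<or> (\<exists>k. n = k + 3)"
    by presburger
  then consider "n = 0" | "n = 1" | "n = 2" | k where "n = k + 3"
    by blast
  then show ?case
  proof cases
    case 1
    have "G2_X (n + 3) - (\<x>^(n+3) - of_nat (n + 3) * \<x>^(n+1) * \<y>) = - 9*\<x> - 6*\<y> - 12"
      by (simp add: 1 G2_init)
    moreover have "\<dots> \<in> O_deg (n + 1)"
      by (rule O_deg_mono, (rule O_deg_intros)+) (simp only: max_le_simps, simp add: 1)
    ultimately show ?thesis by simp
  next
    case 2
    have "G2_X (n + 3) - (\<x>^(n+3) - of_nat (n + 3) * \<x>^(n+1) * \<y>) =
        - 10*\<x>^2 - 4*\<x>*\<y> + 2*\<y>^2 - 8*\<x> + 8*\<y> + 6"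
      by (simp add: 2 G2_init power2_eq_square)
    moreover have "\<dots> \<in> O_deg (n + 1)"
      by (rule O_deg_mono, (rule O_deg_intros)+) (simp only: max_le_simps, simp add: 2)
    ultimately show ?thesis by simp
  next
    case 3
    have "G2_X (n + 3) - (\<x>^(n+3) - of_nat (n + 3) * \<x>^(n+1) * \<y>) =
        - 15*\<x>^3 - 5*\<x>^2*\<y> + 5*\<x>*\<y>^2 - 10*\<x>^2 + 35*\<x>*\<y> + 10*\<y>^2 + 55*\<x> + 50*\<y> + 60"
      by (simp add: 3 G2_init)
    moreover have "\<dots> \<in> O_deg (n + 1)"
      by (rule O_deg_mono, (rule O_deg_intros)+) (simp only: max_le_simps, simp add: 3)
    ultimately show ?thesis by simp
  next
    case (4 k)
    have R: "\<exists>R\<in>O_deg (k + (i + 1)). G2_X (k + (i + 3)) =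
        \<x>^(k+(i+3)) - of_nat (k + (i + 3)) * \<x>^(k+(i+1)) * \<y> + R" if "i < 3" for i
      using O_deg_remainder[OF less[of "k + i"]] 4 that by (simp only: add.assoc)
    obtain R5 where R5: "R5 \<in> O_deg (k + 3)"
        "G2_X (k + 5) = \<x>^(k+5) - of_nat (k + 5) * \<x>^(k+3) * \<y> + R5"
      using R[of 2] by auto
    obtain R4 where R4: "R4 \<in> O_deg (k + 2)"
        "G2_X (k + 4) = \<x>^(k+4) - of_nat (k + 4) * \<x>^(k+2) * \<y> + R4"
      using R[of 1] by auto
    obtain R3 where R3: "R3 \<in> O_deg (k + 1)"
        "G2_X (k + 3) = \<x>^(k+3) - of_nat (k + 3) * \<x>^(k+1) * \<y> + R3"
      using R[of 0] by auto
    \<comment> \<open>The powers \<open>\<x>^(k+5)\<close> from \<open>-\<x> * G2_X (k+4)\<close>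
      and \<open>\<x>^2 * G2_X (k+3)\<close> cancel, and \<open>-\<y> * G2_X (k+4)\<close> raises
      the factor \<open>k + 5\<close> to \<open>k + 6\<close>. Everything left has degree at most
      \<open>k + 4\<close>.\<close>
    have "G2_X (n + 3) - (\<x>^(n+3) - of_nat (n + 3) * \<x>^(n+1) * \<y>) =
        \<x> * R5 - (\<x> + \<y> + 3) * R4 + \<x>^2 * R3 + \<x> * G2_X (k + 1)
        - (\<x> + \<y> + 3) * G2_X (k + 2) - (2*\<y> + 4) * G2_X (k + 3) - G2_X k
        - 3 * \<x>^(k+4) + (\<x> + \<y> + 3) * of_nat (k + 4) * \<x>^(k+2) * \<y>
        - of_nat (k + 3) * \<x>^(k+3) * \<y>"
    proof -
      have e: "n + 3 = k + 6" "n + 1 = k + 4" by (simp_all add: 4)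
      show ?thesis
        unfolding e G2_X_rec R3(2) R4(2) R5(2) power_add of_nat_add of_nat_numeral
        by (simp add: algebra_simps numeral_eq_Suc)
    qed
    moreover have "\<dots> \<in> O_deg (n + 1)"
      by (rule O_deg_mono, (rule O_deg_intros R3 R4 R5 G2_X_deg)+)
         (simp only: max_le_simps, simp add: 4)
    ultimately show ?thesis by simp
  qed
qed

lemma G2_X_coarse:
  obtains R where "R \<in> O_deg (n + 1)"
    "G2_X (n + 3) = \<x>^(n+3) - of_nat (n + 3) * \<x>^(n+1) * \<y> + R"
  using O_deg_remainder[OF G2_X_two_terms[of n]] by blast

definition X_top :: "nat \<Rightarrow> int poly poly" where
  "X_top n = \<x>^n - of_nat n * \<x>^(n-2) * \<y>
     + of_int ((int n ^ 2 - 3 * int n) div 2) * \<x>^(n-4) * \<y>^2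
     - of_nat n * \<x>^(n-3) * \<y> - 3 * of_nat n * \<x>^(n-2)"

text \<open>Index 4 cannot serve as the base: there the coefficient of \<open>\<x>^2\<close> is -10
  instead of -12.\<close>

lemma G2_X_top: "G2_X (n + 5) - X_top (n + 5) \<in> O_deg (n + 2)"
proof (induction n)
  case 0
  have "G2_X 5 - X_top 5 = - 10*\<x>^2 + 35*\<x>*\<y> + 10*\<y>^2 + 55*\<x> + 50*\<y> + 60"
    by (simp add: G2_init X_top_def)
  moreover have "\<dots> \<in> O_deg 2"
    by (rule O_deg_mono, (rule O_deg_intros)+) (simp only: max_le_simps, simp)
  ultimately show ?case by (simp add: numeral_2_eq_2)
next
  case (Suc n)
  define A where "A m = (int m ^ 2 - 3 * int m) div 2" for m
  \<comment> \<open>The numerator grows by an even number, so the integer quotient grows by exactly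
    \<open>n + 4\<close>, with no parity argument.\<close>
  have "int (n + 6) ^ 2 - 3 * int (n + 6) = (int (n + 5) ^ 2 - 3 * int (n + 5)) + (int n + 4) * 2"
    by (simp add: power2_eq_square algebra_simps)
  then have A: "A (n + 6) = A (n + 5) + int (n + 4)"
    unfolding A_def by (simp only: div_mult_self1 div_mult_self2)
  obtain R5 where R5: "R5 \<in> O_deg (n + 2)" "G2_X (n + 5) = X_top (n + 5) + R5"
    using O_deg_remainder[OF Suc] by blast
  have e: "n + 1 + 3 = n + 4" "n + 1 + 1 = n + 2"
    by simp_all
  \<comment> \<open>Two terms suffice for indices \<open>n + 4\<close> and \<open>n + 3\<close>:
    their coefficients have degrees 1 and 2, so the errors stay in
    \<open>O_deg (n + 3)\<close>.\<close>
  obtain R4 where R4: "R4 \<in> O_deg (n + 2)"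
      "G2_X (n + 4) = \<x>^(n+4) - of_nat (n + 4) * \<x>^(n+2) * \<y> + R4"
    by (rule G2_X_coarse[of "n + 1", unfolded e])
  obtain R3 where R3: "R3 \<in> O_deg (n + 1)"
      "G2_X (n + 3) = \<x>^(n+3) - of_nat (n + 3) * \<x>^(n+1) * \<y> + R3"
    using G2_X_coarse[of n] by blast
  have top: "X_top (n + 5) = \<x>^(n+5) - of_nat (n + 5) * \<x>^(n+3) * \<y>
     + of_int (A (n + 5)) * \<x>^(n+1) * \<y>^2
     - of_nat (n + 5) * \<x>^(n+2) * \<y> - 3 * of_nat (n + 5) * \<x>^(n+3)"
    "X_top (n + 6) = \<x>^(n+6) - of_nat (n + 6) * \<x>^(n+4) * \<y>
     + (of_int (A (n + 5)) + of_nat (n + 4)) * \<x>^(n+2) * \<y>^2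
     - of_nat (n + 6) * \<x>^(n+3) * \<y> - 3 * of_nat (n + 6) * \<x>^(n+4)"
    using A by (simp_all add: X_top_def A_def add.commute)
  \<comment> \<open>Besides \<open>\<x> * X_top (n + 5)\<close>, the top part gains
    \<open>(n+4) * \<x>^(n+2) * \<y>^2\<close> from \<open>-\<y> * G2_X (n+4)\<close>,
    \<open>-3 * \<x>^(n+4)\<close> from \<open>-3 * G2_X (n+4)\<close>, and
    \<open>\<x>^(n+3) * \<y>\<close> with factor \<open>(n+4) - (n+3) - 2 = -1\<close>.\<close>
  have "G2_X (n + 6) - X_top (n + 6) =
      \<x> * R5 + \<x> * G2_X (n + 1) - (\<x> + \<y> + 3) * (R4 + G2_X (n + 2)) - G2_X n
      + 3 * of_nat (n + 4) * \<x>^(n+2) * \<y> - 4 * \<x>^(n+3)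
      + (2*\<y> + 4) * of_nat (n + 3) * \<x>^(n+1) * \<y> + (\<x>^2 - 2*\<y> - 4) * R3"
    unfolding G2_X_rec R3(2) R4(2) R5(2) top power_add of_nat_add of_nat_numeral
    by (simp add: algebra_simps numeral_eq_Suc)
  moreover have "\<dots> \<in> O_deg (n + 3)"
    by (rule O_deg_mono, (rule O_deg_intros R3 R4 R5 G2_X_deg)+) (simp only: max_le_simps, simp)
  ultimately show ?case by (simp add: numeral_eq_Suc)
qed

section \<open>Top order terms of \<open>G2_Y\<close>\<close>

text \<open>The bound for the odd index \<open>2 * m + 5\<close> is rounded down, so
  \<open>\<y> * G2_Y (2 * m + 5)\<close> stays one below the top degree
  \<open>3 * m + 9\<close>.\<close>

lemma G2_Y_even_step:
  "G2_Y (2 * m + 6) + \<x>^3 * G2_Y (2 * m + 4) \<in> O_deg (3 * m + 8)"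
proof -
  have "G2_Y (2 * m + 6) + \<x>^3 * G2_Y (2 * m + 4) =
      \<y> * (G2_Y (2 * m + 5) + G2_Y (2 * m + 1))
      + (3*\<x>*\<y> + 9*\<x> + 5*\<y> + 9) * G2_Y (2 * m + 4)
      - (\<x>^3 - 3*\<x>*\<y> - 9*\<x> - 5*\<y> - 9) * G2_Y (2 * m + 2)
      + (\<y>^2 - 2*\<x>^3 + 6*\<x>*\<y> + 18*\<x> + 12*\<y> + 20) * G2_Y (2 * m + 3) - G2_Y (2 * m)"
    unfolding G2_Y_rec by (simp add: algebra_simps)
  also have "\<dots> \<in> O_deg (3 * m + 8)"
    by (rule O_deg_mono, (rule O_deg_intros G2_Y_deg)+)
       (simp only: max_le_simps, intro conjI add_half_le half_le; simp)
  finally show ?thesis .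
qed

text \<open>Here \<open>\<y> * G2_Y (2 * m + 6)\<close> can reach the top degree
  \<open>3 * m + 10\<close>, so it is kept.\<close>

lemma G2_Y_odd_step:
  "G2_Y (2 * m + 7) + \<x>^3 * G2_Y (2 * m + 5) - \<y> * G2_Y (2 * m + 6) \<in> O_deg (3 * m + 9)"
proof -
  have e: "2 * m + 7 = 2 * m + 1 + 6" "2 * m + 5 = 2 * m + 1 + 4" "2 * m + 6 = 2 * m + 1 + 5"
    by simp_all
  have "G2_Y (2 * m + 7) + \<x>^3 * G2_Y (2 * m + 5) - \<y> * G2_Y (2 * m + 6) =
      \<y> * G2_Y (2 * m + 1 + 1)
      + (3*\<x>*\<y> + 9*\<x> + 5*\<y> + 9) * G2_Y (2 * m + 1 + 4)
      - (\<x>^3 - 3*\<x>*\<y> - 9*\<x> - 5*\<y> - 9) * G2_Y (2 * m + 1 + 2)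
      + (\<y>^2 - 2*\<x>^3 + 6*\<x>*\<y> + 18*\<x> + 12*\<y> + 20) * G2_Y (2 * m + 1 + 3)
      - G2_Y (2 * m + 1)"
    unfolding e G2_Y_rec by (simp add: algebra_simps)
  also have "\<dots> \<in> O_deg (3 * m + 9)"
    by (rule O_deg_mono, (rule O_deg_intros G2_Y_deg)+)
       (simp only: max_le_simps, intro conjI add_half_le half_le; simp)
  finally show ?thesis .
qed

lemma G2_Y_even:
  "G2_Y (2 * m + 2) - (- 1) ^ (m + 1) * 2 * \<x>^(3 * m + 3) \<in> O_deg (3 * m + 2)"
proof (induction m rule: induct_nat_012)
  case 0
  have "G2_Y 2 + 2 * \<x>^3 = 6*\<x>*\<y> + \<y>^2 + 18*\<x> + 10*\<y> + 18"
    by (simp add: G2_init)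
  moreover have "\<dots> \<in> O_deg 2"
    by (rule O_deg_mono, (rule O_deg_intros)+) (simp only: max_le_simps, simp)
  ultimately show ?case by (simp add: numeral_2_eq_2 add_ac)
next
  case 1
  have "G2_Y 4 - 2 * \<x>^6 =
     - 12*\<x>^4*\<y> - 4*\<x>^3*\<y>^2 - 36*\<x>^4 - 28*\<x>^3*\<y> + 18*\<x>^2*\<y>^2 + 12*\<x>*\<y>^3
     + \<y>^4 - 40*\<x>^3 + 108*\<x>^2*\<y> + 120*\<x>*\<y>^2 + 24*\<y>^3 + 162*\<x>^2 + 372*\<x>*\<y> + 134*\<y>^2
     + 360*\<x> + 280*\<y> + 198"
    by (simp add: G2_init)
  moreover have "\<dots> \<in> O_deg 5"
    by (rule O_deg_mono, (rule O_deg_intros)+) (simp only: max_le_simps, simp)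
  ultimately show ?case by simp
next
  case (ge2 m)
  have e: "2 * Suc m + 2 = 2 * m + 4" "3 * Suc m + 3 = 3 * m + 6" "3 * Suc m + 2 = 3 * m + 5"
    "2 * Suc (Suc m) + 2 = 2 * m + 6" "3 * Suc (Suc m) + 3 = 3 * m + 9"
    "3 * Suc (Suc m) + 2 = 3 * m + 8"
    by simp_all
  have IH: "G2_Y (2 * m + 4) - (- 1) ^ m * 2 * \<x>^(3 * m + 6) \<in> O_deg (3 * m + 5)"
    using ge2(2)[unfolded e] by simp
  \<comment> \<open>Subtracting \<open>\<x>^3\<close> times the induction hypothesis eliminates
    \<open>G2_Y (2 * m + 4)\<close> and raises its error degree by 3.\<close>
  have "(G2_Y (2 * m + 6) + \<x>^3 * G2_Y (2 * m + 4))
      - \<x>^3 * (G2_Y (2 * m + 4) - (- 1) ^ m * 2 * \<x>^(3 * m + 6)) \<in> O_deg (3 * m + 8)"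
    by (rule O_deg_mono, (rule G2_Y_even_step IH O_deg_intros)+) (simp only: max_le_simps, simp)
  then show ?case
    unfolding e by (simp add: algebra_simps power_add)
qed

text \<open>The factor \<open>2 * m + 1\<close> grows by 2 per step: \<open>-\<x>^3\<close> carries
  the previous one over with reversed sign, and \<open>\<y>\<close> times the even leading term adds
  2 with the matching sign.\<close>

lemma G2_Y_odd:
  "G2_Y (2 * m + 1) - (- 1) ^ m * of_nat (2 * m + 1) * \<x>^(3 * m) * \<y> \<in> O_deg (3 * m)"
proof (induction m rule: less_induct)
  case (less m)
  have "m = 0 \<or> m = 1 \<or> m = 2 \<or> (\<exists>k. m = k + 3)"
    by presburger
  then consider "m = 0" | "m = 1" | "m = 2" | k where "m = k + 3"
    by blast
  then show ?case
  proof cases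
    case 1
    then show ?thesis by (simp add: O_deg_def)
  next
    case 2
    have "G2_Y 3 + 3 * \<x>^3 * \<y> =
        - 6*\<x>^3 + 9*\<x>*\<y>^2 + \<y>^3 + 45*\<x>*\<y> + 18*\<y>^2 + 54*\<x> + 63*\<y> + 60"
      by (simp add: G2_init)
    moreover have "\<dots> \<in> O_deg 3"
      by (rule O_deg_mono, (rule O_deg_intros)+) (simp only: max_le_simps, simp)
    ultimately show ?thesis using 2 by simp
  next
    case 3
    have "G2_Y 5 - 5 * \<x>^6 * \<y> = 10*\<x>^6 - 30*\<x>^4*\<y>^2 - 5*\<x>^3*\<y>^3 - 150*\<x>^4*\<y>
        - 65*\<x>^3*\<y>^2 + 45*\<x>^2*\<y>^3 + 15*\<x>*\<y>^4 + \<y>^5 - 180*\<x>^4 - 205*\<x>^3*\<y>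
        + 360*\<x>^2*\<y>^2 + 240*\<x>*\<y>^3 + 30*\<y>^4 - 190*\<x>^3 + 945*\<x>^2*\<y> + 1200*\<x>*\<y>^2
        + 255*\<y>^3 + 810*\<x>^2 + 2415*\<x>*\<y> + 920*\<y>^2 + 1710*\<x> + 1495*\<y> + 900"
      by (simp add: G2_init)
    moreover have "\<dots> \<in> O_deg 6"
      by (rule O_deg_mono, (rule O_deg_intros)+) (simp only: max_le_simps, simp)
    ultimately show ?thesis using 3 by simp
  next
    case (4 k)
    have e: "2 * (k + 2) + 1 = 2 * k + 5" "3 * (k + 2) = 3 * k + 6"
      "2 * (k + 2) + 2 = 2 * k + 6" "3 * (k + 2) + 3 = 3 * k + 9" "3 * (k + 2) + 2 = 3 * k + 8"
      "2 * m + 1 = 2 * k + 7" "3 * m = 3 * k + 9"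
      using 4 by simp_all
    have IH: "G2_Y (2 * k + 5) - (- 1) ^ k * of_nat (2 * k + 5) * \<x>^(3 * k + 6) * \<y>
        \<in> O_deg (3 * k + 6)"
      using less[of "k + 2", unfolded e] 4 by simp
    have ev: "G2_Y (2 * k + 6) + (- 1) ^ k * 2 * \<x>^(3 * k + 9) \<in> O_deg (3 * k + 8)"
      using G2_Y_even[of "k + 2", unfolded e] by (simp add: add.commute)
    have "(G2_Y (2 * k + 7) + \<x>^3 * G2_Y (2 * k + 5) - \<y> * G2_Y (2 * k + 6))
        - \<x>^3 * (G2_Y (2 * k + 5) - (- 1) ^ k * of_nat (2 * k + 5) * \<x>^(3 * k + 6) * \<y>)
        + \<y> * (G2_Y (2 * k + 6) + (- 1) ^ k * 2 * \<x>^(3 * k + 9)) \<in> O_deg (3 * k + 9)"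
      by (rule O_deg_mono, (rule G2_Y_odd_step IH ev O_deg_intros)+) (simp only: max_le_simps, simp)
    also have "(G2_Y (2 * k + 7) + \<x>^3 * G2_Y (2 * k + 5) - \<y> * G2_Y (2 * k + 6))
        - \<x>^3 * (G2_Y (2 * k + 5) - (- 1) ^ k * of_nat (2 * k + 5) * \<x>^(3 * k + 6) * \<y>)
        + \<y> * (G2_Y (2 * k + 6) + (- 1) ^ k * 2 * \<x>^(3 * k + 9))
        = G2_Y (2 * k + 7) - (- 1) ^ m * of_nat (2 * k + 7) * \<x>^(3 * k + 9) * \<y>"
      by (simp add: 4 algebra_simps power_add)
    finally show ?thesis
      unfolding e .
  qed
qed

section \<open>Both expansions in the original indexing\<close>

theorem proposition4p1:
  shows "(\<forall>n\<ge>5. \<exists>R\<in>O_deg (n - 3).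
            G2_X n = \<x>^n - of_nat n * \<x>^(n-2) * \<y>
              + of_int ((int n ^ 2 - 3 * int n) div 2) * \<x>^(n-4) * \<y>^2
              - of_nat n * \<x>^(n-3) * \<y> - 3 * of_nat n * \<x>^(n-2) + R) \<and>
         G2_Y 0 = 6 \<and>
         (\<forall>n\<ge>1.
            (even n \<longrightarrow> (\<exists>R\<in>O_deg ((3*n - 2) div 2).
               G2_Y n = (-1)^(n div 2) * 2 * \<x>^(3*n div 2) + R)) \<and>
            (odd n \<longrightarrow> (\<exists>R\<in>O_deg ((3*n - 3) div 2).
               G2_Y n = (-1)^((n-1) div 2) * of_nat n * \<x>^((3*n - 3) div 2) * \<y> + R)))"
proof (intro conjI allI impI)
  fix n :: nat
  assume "5 \<le> n"
  then obtain k where "n = k + 5"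
    by (metis add.commute le_Suc_ex)
  then show "\<exists>R\<in>O_deg (n - 3).
            G2_X n = \<x>^n - of_nat n * \<x>^(n-2) * \<y>
              + of_int ((int n ^ 2 - 3 * int n) div 2) * \<x>^(n-4) * \<y>^2
              - of_nat n * \<x>^(n-3) * \<y> - 3 * of_nat n * \<x>^(n-2) + R"
    using O_deg_remainder[OF G2_X_top[of k]] unfolding X_top_def by simp
next
  show "G2_Y 0 = 6" by simp
next
  fix n :: nat
  assume "1 \<le> n" "even n"
  then have "\<exists>m. n = 2 * m + 2"
    by presburger
  then obtain m where n: "n = 2 * m + 2" ..
  \<comment> \<open>All these divisions are exact.\<close>
  then have "(3 * n - 2) div 2 = 3 * m + 2" "n div 2 = m + 1" "3 * n div 2 = 3 * m + 3"
    by auto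
  then show "\<exists>R\<in>O_deg ((3*n - 2) div 2). G2_Y n = (-1)^(n div 2) * 2 * \<x>^(3*n div 2) + R"
    using O_deg_remainder[OF G2_Y_even[of m]] n by (simp only:)
next
  fix n :: nat
  assume "odd n"
  then obtain m where n: "n = 2 * m + 1"
    by (elim oddE)
  then have "(3 * n - 3) div 2 = 3 * m" "(n - 1) div 2 = m"
    by auto
  then show "\<exists>R\<in>O_deg ((3*n - 3) div 2).
      G2_Y n = (-1)^((n-1) div 2) * of_nat n * \<x>^((3*n - 3) div 2) * \<y> + R"
    using O_deg_remainder[OF G2_Y_odd[of m]] n by (simp only:)
qed

end
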